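(* Let $R$ be a commutative ring with $1\ne 0$ and let $n>1$. The group of units of the monoid $\mathcal{MT}_n$ of triangular vector-permutation polynomials over $R$ consists of all elements of the form $$\vec f=(1:f_1)\circ(2:u_2;f_2)\circ\cdots\circ(n:u_n;f_n),$$ where $f_1\in R[x_1]$ is an $R$-automorphism of $R[x_1]$, and $f_i\in R[x_1,\ldots,x_{i-1}]$, $u_i\in R[x_1,\ldots,x_{i-1}]^\times$ for $i=2,\ldots,n$.
   Context: A polynomial $g\in R[x_1,\ldots,x_k]$ is unit-valued if $g(a)\in R^\times$ for all $a\in R^k$. A polynomial $f\in R[x_1]$ is a permutation polynomial on $R$ if it induces a bijection of $R$; $f\in R[x_1]$ is called an $R$-automorphism of $R[x_1]$ if $h\mapsto h(f)$ is an $R$-automorphism of $R[x_1]$, equivalently if $f$ is invertible under composition of polynomials. Composition of $n$-tuples of polynomials is $\vec f\circ\vec g=(f_1(g_1,\ldots,g_n),\ldots,f_n(g_1,\ldots,g_n))$, with identity $(x_1,\dots,x_n)$. $\mathcal{MT}_n$ is the monoid, under $\circ$, of all tuples $(f_1,\ f_2+x_2u_2,\ \ldots,\ f_n+x_nu_n)$ with $f_1\in R[x_1]$ a permutation polynomial on $R$ and, for $2\le i\le n$, $f_i,u_i\in R[x_1,\ldots,x_{i-1}]$ with $u_i$ unit-valued. Notation: $(1:f)=(f(x_1),x_2,\ldots,x_n)$, and for $i>1$, $(i:u;f)=(x_1,\ldots,x_{i-1},f+x_iu,x_{i+1},\ldots,x_n)$. One has $(f_1,f_2+x_2u_2,\ldots,f_n+x_nu_n)=(1:f_1)\circ(2:u_2;f_2)\circ\cdots\circ(n:u_n;f_n)$.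 $S^\times$ denotes the group of multiplicative units of a ring $S$. *)

theory Defs
  imports "HOL-Algebra.QuotRing" "HOL-Library.Poly_Mapping" "HOL-Library.FuncSet"
begin

text \<open>
  Polynomials over \<open>'a\<close> in the variables \<open>x\<^sub>i\<close> (\<open>i :: nat\<close>) are finitely supported
  functions from monomials to coefficients, a monomial being a finitely supported
  function from variable indices to exponents. Addition and (convolution) multiplication
  are those of \<^theory>\<open>HOL-Library.Poly_Mapping\<close>.
\<close>

type_synonym 'a mpol = "(nat \<Rightarrow>\<^sub>0 nat) \<Rightarrow>\<^sub>0 'a"

definition Const :: "'a::comm_ring_1 \<Rightarrow> 'a mpol" where
  "Const c = Poly_Mapping.single 0 c"

definition Var :: "nat \<Rightarrow> 'a::comm_ring_1 mpol" where
  "Var i = Poly_Mapping.single (Poly_Mapping.single i 1) 1"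

text \<open>The ring \<open>R[x\<^sub>1,\<dots>,x\<^sub>k]\<close>\<close>

definition mpol_ring :: "nat \<Rightarrow> 'a::comm_ring_1 mpol ring" where
  "mpol_ring k =
     \<lparr>carrier = {p. \<forall>m \<in> Poly_Mapping.keys p. Poly_Mapping.keys m \<subseteq> {1..k}},
      mult = (*), one = 1, zero = 0, add = (+)\<rparr>"

text \<open>Evaluation at \<open>x\<^sub>i := a i\<close>, with coefficients mapped into the target ring by \<open>\<phi>\<close>.\<close>

definition eval_via ::
  "('a::comm_ring_1 \<Rightarrow> 'b::comm_ring_1) \<Rightarrow> (nat \<Rightarrow> 'b) \<Rightarrow> 'a mpol \<Rightarrow> 'b" where
  "eval_via \<phi> a p =
     (\<Sum>m \<in> Poly_Mapping.keys p. \<phi> (Poly_Mapping.lookup p m) *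
        (\<Prod>i \<in> Poly_Mapping.keys m. a i ^ Poly_Mapping.lookup m i))"

definition eval :: "(nat \<Rightarrow> 'a::comm_ring_1) \<Rightarrow> 'a mpol \<Rightarrow> 'a" where
  "eval a p = eval_via (\<lambda>c. c) a p"

definition subst :: "(nat \<Rightarrow> 'a::comm_ring_1 mpol) \<Rightarrow> 'a mpol \<Rightarrow> 'a mpol" where
  "subst g p = eval_via Const g p"

definition unit_valued :: "nat \<Rightarrow> 'a::comm_ring_1 mpol \<Rightarrow> bool" where
  "unit_valued k g \<longleftrightarrow> g \<in> carrier (mpol_ring k) \<and>
     (\<forall>a \<in> {1..k} \<rightarrow>\<^sub>E UNIV. eval a g dvd 1)"

definition permutation_polynomial :: "'a::comm_ring_1 mpol \<Rightarrow> bool" where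
  "permutation_polynomial f \<longleftrightarrow> f \<in> carrier (mpol_ring 1) \<and> bij (\<lambda>r. eval (\<lambda>_. r) f)"

text \<open>\<open>f \<in> R[x\<^sub>1]\<close> such that \<open>h \<mapsto> h(f)\<close> is an \<open>R\<close>-algebra automorphism of \<open>R[x\<^sub>1]\<close>.\<close>

definition R_automorphism :: "'a::comm_ring_1 mpol \<Rightarrow> bool" where
  "R_automorphism f \<longleftrightarrow> f \<in> carrier (mpol_ring 1) \<and>
     (\<lambda>h. subst (\<lambda>_. f) h) \<in> ring_iso (mpol_ring 1) (mpol_ring 1) \<and>
     (\<forall>c. subst (\<lambda>_. f) (Const c) = Const c)"

text \<open>
  An \<open>n\<close>-tuple \<open>(f\<^sub>1,\<dots>,f\<^sub>n)\<close> is a function on \<open>{1..n}\<close>, \<open>undefined\<close> elsewhere, so that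
  HOL equality is equality of tuples of formal polynomials.
\<close>

definition tuple_comp ::
  "nat \<Rightarrow> (nat \<Rightarrow> 'a::comm_ring_1 mpol) \<Rightarrow> (nat \<Rightarrow> 'a mpol) \<Rightarrow> (nat \<Rightarrow> 'a mpol)" where
  "tuple_comp n f g = (\<lambda>i\<in>{1..n}. subst g (f i))"

definition tuple_id :: "nat \<Rightarrow> (nat \<Rightarrow> 'a::comm_ring_1 mpol)" where
  "tuple_id n = (\<lambda>i\<in>{1..n}. Var i)"

definition MT :: "nat \<Rightarrow> (nat \<Rightarrow> 'a::comm_ring_1 mpol) monoid" where
  "MT n =
     \<lparr>carrier =
        {\<lambda>i\<in>{1..n}. if i = 1 then f 1 else f i + Var i * u i | f u.
           permutation_polynomial (f 1) \<and>
           (\<forall>i\<in>{2..n}. f i \<in> carrier (mpol_ring (i - 1)) \<and> unit_valued (i - 1) (u i))},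
      mult = tuple_comp n, one = tuple_id n\<rparr>"

text \<open>\<open>(1:f) = (f, x\<^sub>2,\<dots>,x\<^sub>n)\<close>\<close>

definition elem_first :: "nat \<Rightarrow> 'a::comm_ring_1 mpol \<Rightarrow> (nat \<Rightarrow> 'a mpol)" where
  "elem_first n f = (\<lambda>j\<in>{1..n}. if j = 1 then f else Var j)"

text \<open>\<open>(i:u;f) = (x\<^sub>1,\<dots>,x\<^sub>i\<^sub>-\<^sub>1, f + x\<^sub>i u, x\<^sub>i\<^sub>+\<^sub>1,\<dots>,x\<^sub>n)\<close>\<close>

definition elem_at ::
  "nat \<Rightarrow> nat \<Rightarrow> 'a::comm_ring_1 mpol \<Rightarrow> 'a mpol \<Rightarrow> (nat \<Rightarrow> 'a mpol)" where
  "elem_at n i u f = (\<lambda>j\<in>{1..n}. if j = i then f + Var i * u else Var j)"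

text \<open>\<open>(1:f\<^sub>1) \<circ> (2:u\<^sub>2;f\<^sub>2) \<circ> \<dots> \<circ> (n:u\<^sub>n;f\<^sub>n)\<close>, bracketed to the left\<close>

definition elem_product ::
  "nat \<Rightarrow> (nat \<Rightarrow> 'a::comm_ring_1 mpol) \<Rightarrow> (nat \<Rightarrow> 'a mpol) \<Rightarrow> (nat \<Rightarrow> 'a mpol)" where
  "elem_product n f u =
     foldl (tuple_comp n) (elem_first n (f 1)) (map (\<lambda>i. elem_at n i (u i) (f i)) [2..<Suc n])"

end

theory Submission imports Defs begin

text \<open>
  Let \<open>F = (f\<^sub>1, f\<^sub>2 + x\<^sub>2 u\<^sub>2, \<dots>, f\<^sub>n + x\<^sub>n u\<^sub>n)\<close>. If \<open>f\<^sub>1\<close> is invertible under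
  substitution and the \<open>u\<^sub>i\<close> are units, then \<open>F \<circ> G = G \<circ> F = id\<close> can be solved for \<open>G\<close> one
  component at a time. Conversely, if \<open>G = (g\<^sub>1, g\<^sub>2 + x\<^sub>2 w\<^sub>2, \<dots>)\<close> is inverse to \<open>F\<close>, the
  coefficient of \<open>x\<^sub>i\<close> in the \<open>i\<close>-th component of \<open>F \<circ> G = id\<close> gives \<open>w\<^sub>i u\<^sub>i(G) = 1\<close>, and
  substituting \<open>F\<close> turns this into \<open>w\<^sub>i(F) u\<^sub>i = 1\<close>.
\<close>

section \<open>Evaluation of polynomials along a ring homomorphism\<close>

locale unital_ring_hom =
  fixes \<phi> :: "'a::comm_ring_1 \<Rightarrow> 'b::comm_ring_1"
  assumes hom_add: "\<phi> (x + y) = \<phi> x + \<phi> y"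
    and hom_mult: "\<phi> (x * y) = \<phi> x * \<phi> y"
    and hom_one: "\<phi> 1 = 1"
begin

lemma hom_zero: "\<phi> 0 = 0"
  using hom_add[of 0 0] by simp

lemma hom_uminus: "\<phi> (- x) = - \<phi> x"
  using hom_add[of x "- x"] hom_zero by (simp add: eq_neg_iff_add_eq_0 add.commute)

lemma hom_sum: "\<phi> (sum f A) = (\<Sum>x\<in>A. \<phi> (f x))"
  by (induction A rule: infinite_finite_induct) (simp_all add: hom_zero hom_add)

lemma hom_prod: "\<phi> (prod f A) = (\<Prod>x\<in>A. \<phi> (f x))"
  by (induction A rule: infinite_finite_induct) (simp_all add: hom_one hom_mult)

lemma hom_power: "\<phi> (x ^ k) = \<phi> x ^ k"
  by (induction k) (simp_all add: hom_one hom_mult)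

text \<open>Source of both composition laws below: taking \<open>\<phi>\<close> to be
  \<open>subst h\<close> or \<open>eval a\<close> yields \<open>subst_subst\<close> and
  \<open>eval_subst\<close>.\<close>

lemma hom_eval_via: "\<phi> (eval_via \<psi> a p) = eval_via (\<lambda>c. \<phi> (\<psi> c)) (\<lambda>i. \<phi> (a i)) p"
  by (simp add: eval_via_def hom_sum hom_prod hom_power hom_mult)

end

lemma poly_mapping_eq_sum_single:
  "p = (\<Sum>m\<in>Poly_Mapping.keys p. Poly_Mapping.single m (Poly_Mapping.lookup p m))"
proof (rule poly_mapping_eqI)
  fix k
  show "Poly_Mapping.lookup p k = Poly_Mapping.lookup
      (\<Sum>m\<in>Poly_Mapping.keys p. Poly_Mapping.single m (Poly_Mapping.lookup p m)) k"
    by (simp add: lookup_sum lookup_single when_def sum.delta' in_keys_iff)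
qed

lemma prod_power_keys:
  fixes a :: "'i \<Rightarrow> 'b::comm_monoid_mult"
  assumes "finite A" "Poly_Mapping.keys m \<subseteq> A"
  shows "(\<Prod>i\<in>Poly_Mapping.keys m. a i ^ Poly_Mapping.lookup m i) =
         (\<Prod>i\<in>A. a i ^ Poly_Mapping.lookup m i)"
  using assms by (intro prod.mono_neutral_left) (auto simp: in_keys_iff)

text \<open>Extending all three products to the union of the supports adds only factors with
  exponent 0; over a common index set the claim is \<open>power_add\<close>.\<close>

lemma prod_power_keys_add:
  fixes a :: "'i \<Rightarrow> 'b::comm_monoid_mult"
  shows "(\<Prod>i\<in>Poly_Mapping.keys (m + m'). a i ^ Poly_Mapping.lookup (m + m') i) =
    (\<Prod>i\<in>Poly_Mapping.keys m. a i ^ Poly_Mapping.lookup m i) *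
    (\<Prod>i\<in>Poly_Mapping.keys m'. a i ^ Poly_Mapping.lookup m' i)"
proof -
  let ?A = "Poly_Mapping.keys m \<union> Poly_Mapping.keys m'"
  have keys: "(\<Prod>i\<in>Poly_Mapping.keys k. a i ^ Poly_Mapping.lookup k i) =
      (\<Prod>i\<in>?A. a i ^ Poly_Mapping.lookup k i)" if "k \<in> {m + m', m, m'}" for k
    using that Poly_Mapping.keys_add[of m m'] by (intro prod_power_keys) auto
  have "(\<Prod>i\<in>?A. a i ^ Poly_Mapping.lookup (m + m') i) =
      (\<Prod>i\<in>?A. a i ^ Poly_Mapping.lookup m i) * (\<Prod>i\<in>?A. a i ^ Poly_Mapping.lookup m' i)"
    by (simp add: lookup_add power_add prod.distrib)
  then show ?thesis
    using keys[of "m + m'"] keys[of m] keys[of m'] by simp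
qed

context unital_ring_hom
begin

lemma eval_via_zero: "eval_via \<phi> a 0 = 0"
  by (simp add: eval_via_def)

lemma eval_via_single:
  "eval_via \<phi> a (Poly_Mapping.single m c) =
     \<phi> c * (\<Prod>i\<in>Poly_Mapping.keys m. a i ^ Poly_Mapping.lookup m i)"
  by (simp add: eval_via_def hom_zero)

lemma eval_via_Const: "eval_via \<phi> a (Const c) = \<phi> c"
  by (simp add: Const_def eval_via_single)

lemma eval_via_Var: "eval_via \<phi> a (Var i) = a i"
  by (simp add: Var_def eval_via_single hom_one)

lemma eval_via_add: "eval_via \<phi> a (p + q) = eval_via \<phi> a p + eval_via \<phi> a q"
  unfolding eval_via_def
  \<comment> \<open>Coefficients of \<open>p\<close> and \<open>q\<close> may cancel, so the support
    of \<open>p + q\<close> can be smaller than the union; \<open>\<phi> 0 = 0\<close> makes the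
    lost terms vanish.\<close>
  by (rule setsum_keys_plus_distrib) (simp_all add: hom_zero hom_add distrib_right)

lemma eval_via_sum: "eval_via \<phi> a (sum f A) = (\<Sum>x\<in>A. eval_via \<phi> a (f x))"
  by (induction A rule: infinite_finite_induct) (simp_all add: eval_via_zero eval_via_add)

text \<open>By additivity it suffices to multiply single terms, where the claim is multiplicativity
  of \<open>\<phi>\<close> and of monomial evaluation.\<close>

lemma eval_via_mult: "eval_via \<phi> a (p * q) = eval_via \<phi> a p * eval_via \<phi> a q"
proof -
  let ?s = "\<lambda>p m. Poly_Mapping.single m (Poly_Mapping.lookup p m)"
  have single: "eval_via \<phi> a (?s p m * ?s q m') = eval_via \<phi> a (?s p m) * eval_via \<phi> a (?s q m')"
    for m m'
    by (simp add: mult_single eval_via_single hom_mult prod_power_keys_add mult_ac)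
  have "p * q = (\<Sum>m\<in>Poly_Mapping.keys p. \<Sum>m'\<in>Poly_Mapping.keys q. ?s p m * ?s q m')"
    by (subst (1) poly_mapping_eq_sum_single[of p], subst (1) poly_mapping_eq_sum_single[of q])
       (simp add: sum_product)
  then have "eval_via \<phi> a (p * q) =
      (\<Sum>m\<in>Poly_Mapping.keys p. eval_via \<phi> a (?s p m)) *
      (\<Sum>m'\<in>Poly_Mapping.keys q. eval_via \<phi> a (?s q m'))"
    by (simp add: eval_via_sum single sum_product)
  then show ?thesis
    by (simp flip: eval_via_sum poly_mapping_eq_sum_single)
qed

text \<open>Evaluation is again an instance of the locale. With \<open>\<phi>\<close> the identity
  this covers \<open>eval\<close>, with \<open>\<phi> = Const\<close> it covers
  \<open>subst\<close>.\<close>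

lemma unital_ring_hom_eval_via: "unital_ring_hom (eval_via \<phi> a)"
  by standard
    (simp_all add: eval_via_add eval_via_mult eval_via_single hom_one flip: single_one)

end

section \<open>Evaluation and substitution as homomorphisms, and their composition laws\<close>

interpretation id_hom: unital_ring_hom "\<lambda>c::'a::comm_ring_1. c"
  by standard simp_all

interpretation Const_hom: unital_ring_hom "Const :: 'a::comm_ring_1 \<Rightarrow> 'a mpol"
  by standard (simp_all add: Const_def single_add mult_single)

interpretation eval_hom: unital_ring_hom "eval a" for a :: "nat \<Rightarrow> 'a::comm_ring_1"
  using id_hom.unital_ring_hom_eval_via[of a] by (simp add: eval_def[abs_def])

interpretation subst_hom: unital_ring_hom "subst g" for g :: "nat \<Rightarrow> 'a::comm_ring_1 mpol"
  using Const_hom.unital_ring_hom_eval_via[of g] by (simp add: subst_def[abs_def])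

lemma subst_Const [simp]: "subst g (Const c) = Const c"
  by (simp add: subst_def Const_hom.eval_via_Const)

lemma subst_Var [simp]: "subst g (Var i) = g i"
  by (simp add: subst_def Const_hom.eval_via_Var)

lemma eval_Const [simp]: "eval a (Const c) = c"
  by (simp add: eval_def id_hom.eval_via_Const)

lemma eval_Var [simp]: "eval a (Var i) = a i"
  by (simp add: eval_def id_hom.eval_via_Var)

lemma subst_subst: "subst h (subst g p) = subst (\<lambda>i. subst h (g i)) p"
  using subst_hom.hom_eval_via[of h Const g p] by (simp add: subst_def[of g] subst_def[of "\<lambda>i. subst h (g i)"])

lemma eval_subst: "eval a (subst g p) = eval (\<lambda>i. eval a (g i)) p"
  using eval_hom.hom_eval_via[of a Const g p] by (simp add: subst_def eval_def[of "\<lambda>i. eval a (g i)"])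

lemma Var_power: "Var i ^ k = Poly_Mapping.single (Poly_Mapping.single i k) 1"
  by (induction k) (simp_all add: Var_def mult_single flip: single_add)

lemma prod_Var_power:
  "(\<Prod>i\<in>Poly_Mapping.keys m. Var i ^ Poly_Mapping.lookup m i) = Poly_Mapping.single m 1"
proof -
  \<comment> \<open>Multiplying monomials adds exponents. For
    \<open>s i = single i (lookup m i)\<close> and \<open>A = keys m\<close> the exponents add up to
    \<open>m\<close>.\<close>
  have "(\<Prod>i\<in>A. Poly_Mapping.single (s i) (1::'a)) = Poly_Mapping.single (sum s A) 1"
    for s :: "nat \<Rightarrow> nat \<Rightarrow>\<^sub>0 nat" and A
    by (induction A rule: infinite_finite_induct) (simp_all add: mult_single)
  then show ?thesis
    by (simp add: Var_power flip: poly_mapping_eq_sum_single)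
qed

lemma subst_id [simp]: "subst Var p = p"
  by (simp add: subst_def eval_via_def prod_Var_power Const_def mult_single
      flip: poly_mapping_eq_sum_single)

section \<open>The subrings \<open>R[x_1,...,x_k]\<close>\<close>

lemma mpol_ring_simps [simp]:
  "mult (mpol_ring k) = (*)" "add (mpol_ring k) = (+)"
  "one (mpol_ring k) = 1" "zero (mpol_ring k) = 0"
  by (simp_all add: mpol_ring_def)

lemma mpol_ring_iff:
  "p \<in> carrier (mpol_ring k) \<longleftrightarrow>
     (\<forall>m\<in>Poly_Mapping.keys p. Poly_Mapping.keys m \<subseteq> {1..k})"
  by (simp add: mpol_ring_def)

lemma mpol_ring_mono: "p \<in> carrier (mpol_ring k) \<Longrightarrow> k \<le> l \<Longrightarrow> p \<in> carrier (mpol_ring l)"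
  unfolding mpol_ring_iff by fastforce

lemma mpol_ring_Const: "Const c \<in> carrier (mpol_ring k)"
  by (simp add: mpol_ring_iff Const_def)

lemma mpol_ring_zero: "0 \<in> carrier (mpol_ring k)"
  by (simp add: mpol_ring_iff)

lemma mpol_ring_one: "1 \<in> carrier (mpol_ring k)"
  by (simp add: mpol_ring_iff)

lemma mpol_ring_Var: "1 \<le> i \<Longrightarrow> i \<le> k \<Longrightarrow> Var i \<in> carrier (mpol_ring k)"
  by (simp add: mpol_ring_iff Var_def)

lemma mpol_ring_add:
  "p \<in> carrier (mpol_ring k) \<Longrightarrow> q \<in> carrier (mpol_ring k) \<Longrightarrow> p + q \<in> carrier (mpol_ring k)"
  unfolding mpol_ring_iff using Poly_Mapping.keys_add[of p q] by blast

lemma mpol_ring_uminus: "p \<in> carrier (mpol_ring k) \<Longrightarrow> - p \<in> carrier (mpol_ring k)"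
  unfolding mpol_ring_iff by (simp add: keys_def)

lemma mpol_ring_mult:
  assumes "p \<in> carrier (mpol_ring k)" "q \<in> carrier (mpol_ring k)"
  shows "p * q \<in> carrier (mpol_ring k)"
  unfolding mpol_ring_iff
proof
  fix m assume "m \<in> Poly_Mapping.keys (p * q)"
  then obtain a b where "m = a + b" "a \<in> Poly_Mapping.keys p" "b \<in> Poly_Mapping.keys q"
    using keys_mult[of p q] by blast
  then show "Poly_Mapping.keys m \<subseteq> {1..k}"
    using assms Poly_Mapping.keys_add[of a b] unfolding mpol_ring_iff by blast
qed

lemma mpol_ring_sum:
  "(\<And>x. x \<in> A \<Longrightarrow> f x \<in> carrier (mpol_ring k)) \<Longrightarrow> sum f A \<in> carrier (mpol_ring k)"
  by (induction A rule: infinite_finite_induct) (simp_all add: mpol_ring_zero mpol_ring_add)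

lemma mpol_ring_prod:
  "(\<And>x. x \<in> A \<Longrightarrow> f x \<in> carrier (mpol_ring k)) \<Longrightarrow> prod f A \<in> carrier (mpol_ring k)"
  by (induction A rule: infinite_finite_induct) (simp_all add: mpol_ring_one mpol_ring_mult)

lemma mpol_ring_power: "p \<in> carrier (mpol_ring k) \<Longrightarrow> p ^ j \<in> carrier (mpol_ring k)"
  by (induction j) (simp_all add: mpol_ring_one mpol_ring_mult)

lemma mpol_ring_subst:
  assumes "p \<in> carrier (mpol_ring k)" "\<And>i. i \<in> {1..k} \<Longrightarrow> g i \<in> carrier (mpol_ring l)"
  shows "subst g p \<in> carrier (mpol_ring l)"
proof -
  have "g i \<in> carrier (mpol_ring l)"
    if "m \<in> Poly_Mapping.keys p" "i \<in> Poly_Mapping.keys m" for m i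
    using assms(1) that by (intro assms(2)) (unfold mpol_ring_iff, blast)
  then show ?thesis
    unfolding subst_def eval_via_def
    by (intro mpol_ring_sum mpol_ring_mult mpol_ring_Const mpol_ring_prod mpol_ring_power)
qed

text \<open>A triangular substitution brings in no variable beyond \<open>x_k\<close>, because the
  rings increase with the index. This keeps the components of inverse tuples triangular.\<close>

lemma mpol_ring_subst_triangular:
  assumes "p \<in> carrier (mpol_ring k)" "\<And>j. j \<in> {1..k} \<Longrightarrow> g j \<in> carrier (mpol_ring j)"
  shows "subst g p \<in> carrier (mpol_ring k)"
  using assms(1)
proof (rule mpol_ring_subst)
  fix j assume "j \<in> {1..k}"
  then show "g j \<in> carrier (mpol_ring k)"
    using mpol_ring_mono[OF assms(2)] by simp
qed

lemma eval_via_cong: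
  assumes "p \<in> carrier (mpol_ring k)" "\<And>i. i \<in> {1..k} \<Longrightarrow> a i = b i"
  shows "eval_via \<phi> a p = eval_via \<phi> b p"
proof -
  have "a i = b i" if "m \<in> Poly_Mapping.keys p" "i \<in> Poly_Mapping.keys m" for m i
    using assms that unfolding mpol_ring_iff by blast
  then show ?thesis
    unfolding eval_via_def by (intro sum.cong prod.cong arg_cong2[of _ _ _ _ "(*)"]) simp_all
qed

lemma subst_cong:
  "p \<in> carrier (mpol_ring k) \<Longrightarrow> (\<And>i. i \<in> {1..k} \<Longrightarrow> g i = h i) \<Longrightarrow> subst g p = subst h p"
  unfolding subst_def by (rule eval_via_cong)

lemma subst_eq_self:
  "p \<in> carrier (mpol_ring k) \<Longrightarrow> (\<And>i. i \<in> {1..k} \<Longrightarrow> g i = Var i) \<Longrightarrow> subst g p = p"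
  using subst_cong[of p k g Var] by simp

lemma Units_mpol_ring_iff:
  "u \<in> Units (mpol_ring k) \<longleftrightarrow>
     u \<in> carrier (mpol_ring k) \<and> (\<exists>v\<in>carrier (mpol_ring k). v * u = 1)"
  by (auto simp: Units_def mult.commute)

text \<open>Evaluation is a ring homomorphism, so it carries \<open>v * u = 1\<close> to an equation
  showing that each value of \<open>u\<close> divides 1.\<close>

lemma unit_valued_if_unit:
  assumes "u \<in> carrier (mpol_ring k)" "v * u = 1"
  shows "unit_valued k u"
proof -
  have "eval a u dvd 1" for a
    using assms(2) eval_hom.hom_mult[of a v u] by (metis dvd_triv_right eval_hom.hom_one)
  then show ?thesis
    using assms(1) by (simp add: unit_valued_def)
qed

section \<open>Automorphisms of \<open>R[x_1]\<close> and invertibility under composition\<close>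

lemma subst_univariate_in_mpol_ring:
  assumes "p \<in> carrier (mpol_ring 1)" "f \<in> carrier (mpol_ring 1)"
  shows "subst (\<lambda>_. f) p \<in> carrier (mpol_ring 1)"
  using assms by (rule mpol_ring_subst)

lemma subst_univariate_eq_self: "p \<in> carrier (mpol_ring 1) \<Longrightarrow> subst (\<lambda>_. Var 1) p = p"
  by (rule subst_eq_self) auto

text \<open>Surjectivity of \<open>h \<mapsto> h(f)\<close> supplies \<open>g\<close> with
  \<open>g(f) = x_1\<close>, and injectivity then forces \<open>f(g) = x_1\<close>. Conversely,
  substituting \<open>g\<close> inverts substituting \<open>f\<close>.\<close>

lemma R_automorphism_iff:
  "R_automorphism f \<longleftrightarrow> f \<in> carrier (mpol_ring 1) \<and>
     (\<exists>g\<in>carrier (mpol_ring 1). subst (\<lambda>_. f) g = Var 1 \<and> subst (\<lambda>_. g) f = Var 1)"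
    (is "_ \<longleftrightarrow> _ \<and> ?inv")
proof safe
  assume aut: "R_automorphism f"
  let ?S = "subst (\<lambda>_. f)" and ?R = "carrier (mpol_ring 1)"
  show f: "f \<in> ?R"
    using aut by (simp add: R_automorphism_def)
  have bij: "bij_betw ?S ?R ?R"
    using aut by (simp add: R_automorphism_def ring_iso_def)
  have Var1: "Var 1 \<in> ?R"
    by (simp add: mpol_ring_Var)
  then have "Var 1 \<in> ?S ` ?R"
    by (simp only: bij_betw_imp_surj_on[OF bij])
  then obtain g where g: "g \<in> ?R" "?S g = Var 1"
    by (elim imageE) simp
  \<comment> \<open>Both sides equal \<open>f\<close>: the left one is \<open>f\<close> evaluated at
    \<open>g(f) = x_1\<close>.\<close>
  have "?S (subst (\<lambda>_. g) f) = ?S (Var 1)"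
    using g(2) subst_univariate_eq_self[OF f] by (simp add: subst_subst)
  then have "subst (\<lambda>_. g) f = Var 1"
    by (rule inj_onD[OF bij_betw_imp_inj_on[OF bij] _ subst_univariate_in_mpol_ring[OF f g(1)] Var1])
  with g show ?inv by (intro bexI[of _ g] conjI)
next
  fix g assume f: "f \<in> carrier (mpol_ring 1)" and g: "g \<in> carrier (mpol_ring 1)"
    and fg: "subst (\<lambda>_. f) g = Var 1" "subst (\<lambda>_. g) f = Var 1"
  have "bij_betw (subst (\<lambda>_. f)) (carrier (mpol_ring 1)) (carrier (mpol_ring 1))"
    by (rule bij_betw_byWitness[where f' = "subst (\<lambda>_. g)"])
      (use f g in \<open>simp_all add: subst_subst fg subst_univariate_eq_self image_subset_iff
        subst_univariate_in_mpol_ring del: One_nat_def\<close>)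
  then show "R_automorphism f"
    using f subst_univariate_in_mpol_ring[OF _ f]
    by (simp add: R_automorphism_def ring_iso_def ring_hom_def subst_hom.hom_add
        subst_hom.hom_mult subst_hom.hom_one)
qed

text \<open>Evaluation turns composition of polynomials into composition of functions, so the
  compositional inverse of \<open>f\<close> induces the inverse function.\<close>

lemma R_automorphism_permutation_polynomial:
  assumes "R_automorphism f"
  shows "permutation_polynomial f"
proof -
  obtain g where f: "f \<in> carrier (mpol_ring 1)" and g: "g \<in> carrier (mpol_ring 1)"
    and fg: "subst (\<lambda>_. f) g = Var 1" "subst (\<lambda>_. g) f = Var 1"
    using assms by (auto simp: R_automorphism_iff)
  have "eval (\<lambda>_. eval (\<lambda>_. r) f) g = r" "eval (\<lambda>_. eval (\<lambda>_. r) g) f = r" for r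
    by (simp_all add: fg flip: eval_subst)
  then have "bij (\<lambda>r. eval (\<lambda>_. r) f)"
    by (intro o_bij[where g = "\<lambda>r. eval (\<lambda>_. r) g"]) (simp_all add: fun_eq_iff)
  with f show ?thesis
    by (simp add: permutation_polynomial_def)
qed

section \<open>Triangular tuples and products of elementary ones\<close>

definition triangular ::
  "nat \<Rightarrow> (nat \<Rightarrow> 'a::comm_ring_1 mpol) \<Rightarrow> (nat \<Rightarrow> 'a mpol) \<Rightarrow> nat \<Rightarrow> 'a mpol" where
  "triangular n f u = (\<lambda>i\<in>{1..n}. if i = 1 then f 1 else f i + Var i * u i)"

lemma MT_simps [simp]:
  "mult (MT n) = tuple_comp n" "one (MT n) = tuple_id n"
  by (simp_all add: MT_def)

lemma carrier_MT:
  "F \<in> carrier (MT n) \<longleftrightarrow> (\<exists>f u. F = triangular n f u \<and> permutation_polynomial (f 1) \<and>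
     (\<forall>i\<in>{2..n}. f i \<in> carrier (mpol_ring (i - 1)) \<and> unit_valued (i - 1) (u i)))"
  by (auto simp: MT_def triangular_def)

lemma tuple_comp_eq_id_iff:
  "tuple_comp n F G = tuple_id n \<longleftrightarrow> (\<forall>i\<in>{1..n}. subst G (F i) = Var i)"
  by (auto simp: tuple_comp_def tuple_id_def fun_eq_iff restrict_def)

lemma triangular_in_mpol_ring:
  assumes "f 1 \<in> carrier (mpol_ring 1)"
    and "\<And>i. i \<in> {2..n} \<Longrightarrow> f i \<in> carrier (mpol_ring (i - 1)) \<and> u i \<in> carrier (mpol_ring (i - 1))"
    and "i \<in> {1..n}"
  shows "triangular n f u i \<in> carrier (mpol_ring i)"
proof (cases "i = 1")
  case False
  then have "f i \<in> carrier (mpol_ring i)" "u i \<in> carrier (mpol_ring i)"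
    using assms(2)[of i] assms(3) by (auto intro: mpol_ring_mono)
  with assms(3) False show ?thesis
    by (auto simp: triangular_def intro!: mpol_ring_add mpol_ring_mult mpol_ring_Var)
qed (use assms in \<open>auto simp: triangular_def\<close>)

text \<open>Multiplying by the factors from left to right fills in one component at a time and
  leaves the earlier ones alone.\<close>

lemma elem_product_eq_triangular:
  assumes "n \<ge> 1" "f 1 \<in> carrier (mpol_ring 1)"
    and fu: "\<And>i. i \<in> {2..n} \<Longrightarrow> f i \<in> carrier (mpol_ring (i - 1)) \<and> u i \<in> carrier (mpol_ring (i - 1))"
  shows "elem_product n f u = triangular n f u"
proof -
  \<comment> \<open>Induction needs the partial products: after the factor with index
    \<open>k\<close>, the components beyond \<open>k\<close> are still variables.\<close>
  have partial: "foldl (tuple_comp n) (elem_first n (f 1)) (map (\<lambda>i. elem_at n i (u i) (f i)) [2..<Suc k]) =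
      (\<lambda>i\<in>{1..n}. if i \<le> k then triangular n f u i else Var i)" if "1 \<le> k" "k \<le> n" for k
    using that
  proof (induction k rule: dec_induct)
    case base
    then show ?case
      by (auto simp: elem_first_def triangular_def fun_eq_iff)
  next
    case (step k)
    let ?E = "elem_at n (Suc k) (u (Suc k)) (f (Suc k))"
    \<comment> \<open>Components up to \<open>k\<close> do not involve \<open>x_{k+1}\<close>, the
      only variable moved by the new factor.\<close>
    have "subst ?E (triangular n f u i) = triangular n f u i" if "1 \<le> i" "i \<le> k" for i
    proof (rule subst_eq_self)
      show "triangular n f u i \<in> carrier (mpol_ring i)"
        using that step.prems fu assms(2) by (intro triangular_in_mpol_ring) auto
    qed (use that step.prems in \<open>auto simp: elem_at_def\<close>)
    moreover have "?E (Suc k) = triangular n f u (Suc k)"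
      using step by (simp add: elem_at_def triangular_def)
    moreover have "?E i = Var i" if "1 \<le> i" "i \<le> n" "i \<noteq> Suc k" for i
      using that by (simp add: elem_at_def)
    ultimately have "tuple_comp n (\<lambda>i\<in>{1..n}. if i \<le> k then triangular n f u i else Var i) ?E =
        (\<lambda>i\<in>{1..n}. if i \<le> Suc k then triangular n f u i else Var i)"
      using step by (auto simp: tuple_comp_def fun_eq_iff le_Suc_eq)
    moreover have "[2..<Suc (Suc k)] = [2..<Suc k] @ [Suc k]"
      using step.hyps by simp
    moreover note step.IH
    ultimately show ?case
      using step.prems by (simp only: map_append foldl_append list.map foldl.simps Suc_leD)
  qed
  show ?thesis
    unfolding elem_product_def partial[OF assms(1) order.refl]
    by (auto simp: triangular_def fun_eq_iff)
qed

text \<open>Neither \<open>a\<close> nor \<open>b\<close> involves \<open>x_i\<close>, so any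
  \<open>c\<close> may be substituted for \<open>x_i\<close>, giving \<open>a + c * b = 0\<close>.
  The choices \<open>c = 0\<close> and \<open>c = 1\<close> suffice.\<close>

lemma coeffs_eq_zero:
  assumes "a \<in> carrier (mpol_ring (i - 1))" "b \<in> carrier (mpol_ring (i - 1))" "i \<ge> 1"
    and "a + Var i * b = 0"
  shows "a = 0" "b = 0"
proof -
  have *: "a + c * b = 0" for c
  proof -
    have "subst (Var(i := c)) a = a" "subst (Var(i := c)) b = b"
      using assms(1-3) by (auto intro!: subst_eq_self)
    then show ?thesis
      using assms(4) subst_hom.hom_add[of "Var(i := c)" a "Var i * b"]
      by (simp add: subst_hom.hom_mult subst_hom.hom_zero)
  qed
  show "a = 0" using *[of 0] by simp
  with *[of 1] show "b = 0" by simp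
qed

section \<open>Construction of an inverse\<close>

text \<open>For \<open>v\<^sub>i\<close> inverse to \<open>u\<^sub>i\<close>, the recursion is \<open>x\<^sub>i = f\<^sub>i(G) + G\<^sub>i u\<^sub>i(G)\<close> solved for \<open>G\<^sub>i\<close>.\<close>

lemma inverse_recursion_exists:
  assumes fv: "\<And>i. i \<in> {2..n} \<Longrightarrow> f i \<in> carrier (mpol_ring (i - 1)) \<and> v i \<in> carrier (mpol_ring (i - 1))"
    and "n \<ge> 1"
  shows "\<exists>G. G 1 = g\<^sub>1 \<and> (\<forall>i\<in>{2..n}. G i = (Var i - subst G (f i)) * subst G (v i))"
  using assms(2,1)
proof (induction n rule: dec_induct)
  case base
  show ?case by (intro exI[of _ "\<lambda>_. g\<^sub>1"]) simp
next
  case (step k)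
  then obtain G where G: "G 1 = g\<^sub>1"
    "\<And>i. i \<in> {2..k} \<Longrightarrow> G i = (Var i - subst G (f i)) * subst G (v i)"
    by force
  define H where "H = G(Suc k := (Var (Suc k) - subst G (f (Suc k))) * subst G (v (Suc k)))"
  \<comment> \<open>For \<open>i \<le> Suc k\<close> such a \<open>p\<close> involves at most
    \<open>x_1,...,x_k\<close>, so the new value at \<open>Suc k\<close> does not affect the
    substitution.\<close>
  have subst_H: "subst H p = subst G p" if "i \<in> {2..Suc k}" "p \<in> carrier (mpol_ring (i - 1))" for i p
    by (rule subst_cong[OF that(2)]) (use that(1) in \<open>auto simp: H_def\<close>)
  have "H i = (Var i - subst H (f i)) * subst H (v i)" if "i \<in> {2..Suc k}" for i
    using that G(2)[of i] subst_H[OF that] step.prems[OF that]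
    by (cases "i = Suc k") (simp_all, simp_all add: H_def)
  moreover have "H 1 = g\<^sub>1"
    using step.hyps G(1) by (simp add: H_def)
  ultimately show ?case by blast
qed

text \<open>The recursion is designed to give \<open>F \<circ> G = id\<close>. The other order is
  checked by a separate induction on the component, and membership in \<open>MT n\<close> by
  splitting \<open>G i\<close> into a part free of \<open>x_i\<close> and a multiple of
  \<open>x_i\<close>.\<close>

lemma triangular_inverse_exists:
  assumes f1: "R_automorphism (f 1)"
    and f: "\<And>i. i \<in> {2..n} \<Longrightarrow> f i \<in> carrier (mpol_ring (i - 1))"
    and u: "\<And>i. i \<in> {2..n} \<Longrightarrow> u i \<in> Units (mpol_ring (i - 1))"
    and n: "n \<ge> 1"
  shows "\<exists>G\<in>carrier (MT n). tuple_comp n G (triangular n f u) = tuple_id n \<and>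
           tuple_comp n (triangular n f u) G = tuple_id n"
proof -
  let ?F = "triangular n f u"
  obtain g\<^sub>1 where f1': "f 1 \<in> carrier (mpol_ring 1)" and g1: "g\<^sub>1 \<in> carrier (mpol_ring 1)"
    and fg1: "subst (\<lambda>_. f 1) g\<^sub>1 = Var 1" "subst (\<lambda>_. g\<^sub>1) (f 1) = Var 1"
    using f1 by (auto simp: R_automorphism_iff)
  have u': "u i \<in> carrier (mpol_ring (i - 1))" if "i \<in> {2..n}" for i
    using u[OF that] by (simp add: Units_mpol_ring_iff)
  have "\<exists>v. \<forall>i\<in>{2..n}. v i \<in> carrier (mpol_ring (i - 1)) \<and> v i * u i = 1"
    by (rule bchoice) (use u in \<open>unfold Units_mpol_ring_iff, blast\<close>)
  then obtain v where v: "v i \<in> carrier (mpol_ring (i - 1))" and vu: "v i * u i = 1"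
    if "i \<in> {2..n}" for i
    by blast
  obtain G where G1: "G 1 = g\<^sub>1"
    and G: "\<And>i. i \<in> {2..n} \<Longrightarrow> G i = (Var i - subst G (f i)) * subst G (v i)"
    using inverse_recursion_exists[of n f v g\<^sub>1] f v n by blast
  \<comment> \<open>Strong induction: the recursion expresses \<open>G i\<close> through
    \<open>x_i\<close> and the earlier components of \<open>G\<close>.\<close>
  have G_ring: "G i \<in> carrier (mpol_ring i)" if "i \<in> {1..n}" for i
    using that
  proof (induction i rule: less_induct)
    case (less i)
    show ?case
    proof (cases "i = 1")
      case False
      then have i: "i \<in> {2..n}" using less.prems by auto
      have "subst G p \<in> carrier (mpol_ring (i - 1))" if "p \<in> carrier (mpol_ring (i - 1))" for p
        using that by (rule mpol_ring_subst_triangular) (rule less.IH, use i in auto)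
      then have "subst G p \<in> carrier (mpol_ring i)" if "p \<in> carrier (mpol_ring (i - 1))" for p
        using that mpol_ring_mono diff_le_self by blast
      then show ?thesis
        unfolding G[OF i] diff_conv_add_uminus
        using f[OF i] v[OF i] i
        by (intro mpol_ring_mult mpol_ring_add mpol_ring_uminus mpol_ring_Var) auto
    qed (simp add: G1 g1 flip: One_nat_def)
  qed
  have subst_G_ring: "subst G p \<in> carrier (mpol_ring (i - 1))"
    if "p \<in> carrier (mpol_ring (i - 1))" "i \<in> {2..n}" for p i
    using that(1) by (rule mpol_ring_subst_triangular) (rule G_ring, use that(2) in auto)
  \<comment> \<open>Expanding the recursion as \<open>- f_i(G) v_i(G) + x_i v_i(G)\<close> gives the
    triangular data of \<open>G\<close>.\<close>
  define g where "g = (\<lambda>i. if i = 1 then g\<^sub>1 else - subst G (f i) * subst G (v i))"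
  define w where "w = (\<lambda>i. subst G (v i))"
  let ?G = "triangular n g w"
  \<comment> \<open>Agreement is claimed on \<open>{1..n}\<close> only: \<open>?G\<close> is
    \<open>undefined\<close> elsewhere, while the recursion does not constrain \<open>G\<close>
    there.\<close>
  have G_eq: "?G i = G i" if "i \<in> {1..n}" for i
    using that G[of i] G1 by (auto simp: triangular_def g_def w_def algebra_simps)
  have subst_G_uv: "subst G (u i) * w i = 1" if "i \<in> {2..n}" for i
    using arg_cong[OF vu[OF that], of "subst G"]
    by (simp add: w_def subst_hom.hom_mult subst_hom.hom_one mult.commute)
  have "R_automorphism g\<^sub>1"
    unfolding R_automorphism_iff using f1' g1 fg1 by blast
  moreover have "g i \<in> carrier (mpol_ring (i - 1)) \<and> unit_valued (i - 1) (w i)"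
    if "i \<in> {2..n}" for i
    using that subst_G_ring f[OF that] v[OF that] subst_G_uv[OF that]
    by (auto simp: g_def w_def intro!: mpol_ring_mult mpol_ring_uminus unit_valued_if_unit)
  ultimately have "?G \<in> carrier (MT n)"
    unfolding carrier_MT using R_automorphism_permutation_polynomial by (metis g_def)
  moreover have "tuple_comp n ?F ?G = tuple_id n"
    unfolding tuple_comp_eq_id_iff
  proof
    fix i assume i: "i \<in> {1..n}"
    show "subst ?G (?F i) = Var i"
    proof (cases "i = 1")
      case True
      have "subst ?G (f 1) = subst (\<lambda>_. g\<^sub>1) (f 1)"
        by (rule subst_cong[OF f1']) (use n G_eq[of 1] G1 in auto)
      with True i fg1(2) show ?thesis by (simp add: triangular_def)
    next
      case False
      then have i2: "i \<in> {2..n}" using i by auto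
      have "subst ?G p = subst G p" if "p \<in> carrier (mpol_ring (i - 1))" for p
        by (rule subst_cong[OF that]) (use i G_eq in auto)
      then have "subst ?G (?F i) = subst G (f i) + G i * subst G (u i)"
        using i2 G_eq[OF i] f[OF i2] u'[OF i2]
        by (simp add: triangular_def subst_hom.hom_add subst_hom.hom_mult)
      also have "\<dots> = subst G (f i) + (Var i - subst G (f i)) * (subst G (u i) * w i)"
        using G[OF i2] by (simp add: w_def mult_ac)
      finally show ?thesis
        using subst_G_uv[OF i2] by simp
    qed
  qed
  \<comment> \<open>Strong induction: once \<open>F\<close> sends each earlier \<open>G j\<close> to
    \<open>x_j\<close>, substituting \<open>G\<close> and then \<open>F\<close> fixes
    \<open>R[x_1,...,x_{i-1}]\<close>. The recursion for \<open>G i\<close> then becomes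
    \<open>(F_i - f_i) v_i = x_i u_i v_i\<close>.\<close>
  moreover have "subst ?F (G i) = Var i" if "i \<in> {1..n}" for i
    using that
  proof (induction i rule: less_induct)
    case (less i)
    show ?case
    proof (cases "i = 1")
      case True
      have "subst ?F g\<^sub>1 = subst (\<lambda>_. f 1) g\<^sub>1"
        by (rule subst_cong[OF g1]) (use n in \<open>auto simp: triangular_def\<close>)
      with True fg1(1) G1 show ?thesis by simp
    next
      case False
      then have i2: "i \<in> {2..n}" using less.prems by auto
      have "subst ?F (subst G p) = p" if "p \<in> carrier (mpol_ring (i - 1))" for p
        unfolding subst_subst by (rule subst_eq_self[OF that]) (use less i2 in auto)
      then have "subst ?F (G i) = (?F i - f i) * v i"
        using G[OF i2] f[OF i2] v[OF i2] subst_hom.hom_add[of ?F "Var i" "- subst G (f i)"]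
        by (simp add: subst_hom.hom_mult subst_hom.hom_uminus)
      also have "\<dots> = Var i * (v i * u i)"
        using i2 by (simp add: triangular_def mult_ac)
      finally show ?thesis
        using vu[OF i2] by simp
    qed
  qed
  then have "tuple_comp n ?G ?F = tuple_id n"
    unfolding tuple_comp_eq_id_iff using G_eq by simp
  ultimately show ?thesis by blast
qed

section \<open>Constraints that invertibility puts on the components\<close>

lemma triangular_invertible_components:
  assumes f: "f 1 \<in> carrier (mpol_ring 1)"
      "\<And>i. i \<in> {2..n} \<Longrightarrow> f i \<in> carrier (mpol_ring (i - 1)) \<and> u i \<in> carrier (mpol_ring (i - 1))"
    and g: "g 1 \<in> carrier (mpol_ring 1)"
      "\<And>i. i \<in> {2..n} \<Longrightarrow> g i \<in> carrier (mpol_ring (i - 1)) \<and> w i \<in> carrier (mpol_ring (i - 1))"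
    and inv: "tuple_comp n (triangular n g w) (triangular n f u) = tuple_id n"
      "tuple_comp n (triangular n f u) (triangular n g w) = tuple_id n"
    and n: "n \<ge> 1"
  shows "R_automorphism (f 1)" "\<And>i. i \<in> {2..n} \<Longrightarrow> u i \<in> Units (mpol_ring (i - 1))"
proof -
  let ?F = "triangular n f u" and ?G = "triangular n g w"
  have GF: "subst ?F (?G i) = Var i" and FG: "subst ?G (?F i) = Var i" if "i \<in> {1..n}" for i
    using inv that by (auto simp: tuple_comp_eq_id_iff)
  have first: "?F 1 = f 1" "?G 1 = g 1"
    using n by (simp_all add: triangular_def)
  \<comment> \<open>Only the first component of a tuple matters when substituting into
    \<open>R[x_1]\<close>, so \<open>f 1\<close> and \<open>g 1\<close> are mutually inverse under
    composition.\<close>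
  have "subst ?F (g 1) = subst (\<lambda>_. f 1) (g 1)" "subst ?G (f 1) = subst (\<lambda>_. g 1) (f 1)"
    using f(1) g(1) first by (auto intro!: subst_cong[of _ 1])
  then show "R_automorphism (f 1)"
    unfolding R_automorphism_iff using f(1) g(1) GF[of 1] FG[of 1] n first by auto
  show "u i \<in> Units (mpol_ring (i - 1))" if i: "i \<in> {2..n}" for i
  proof -
    have ring: "f i \<in> carrier (mpol_ring (i - 1))" "u i \<in> carrier (mpol_ring (i - 1))"
      "g i \<in> carrier (mpol_ring (i - 1))" "w i \<in> carrier (mpol_ring (i - 1))"
      using f(2)[OF i] g(2)[OF i] by auto
    have G_ring: "subst ?G p \<in> carrier (mpol_ring (i - 1))" if "p \<in> carrier (mpol_ring (i - 1))" for p
      by (rule mpol_ring_subst_triangular[OF that], rule triangular_in_mpol_ring[OF g])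
        (use i in auto)
    have F_ring: "subst ?F p \<in> carrier (mpol_ring (i - 1))" if "p \<in> carrier (mpol_ring (i - 1))" for p
      by (rule mpol_ring_subst_triangular[OF that], rule triangular_in_mpol_ring[OF f])
        (use i in auto)
    \<comment> \<open>These are the two coefficients of \<open>F_i(G) - x_i\<close>, viewed as a
      polynomial of degree at most 1 in \<open>x_i\<close>. Writing \<open>+ - 1\<close> lets the
      closure rules for sums and negatives apply.\<close>
    let ?a = "subst ?G (f i) + g i * subst ?G (u i)" and ?b = "w i * subst ?G (u i) + - 1"
    have "subst ?G (?F i) = subst ?G (f i) + ?G i * subst ?G (u i)"
      using i by (simp add: triangular_def[of n f u] subst_hom.hom_add subst_hom.hom_mult)
    moreover have "?G i = g i + Var i * w i"
      using i by (simp add: triangular_def)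
    ultimately have "?a + Var i * ?b = 0"
      using FG[of i] i by (simp add: algebra_simps)
    moreover have "?a \<in> carrier (mpol_ring (i - 1))" "?b \<in> carrier (mpol_ring (i - 1))"
      by (intro mpol_ring_add mpol_ring_mult mpol_ring_uminus mpol_ring_one ring G_ring)+
    ultimately have "?b = 0"
      using i coeffs_eq_zero(2)[of ?a i ?b] by simp
    then have "w i * subst ?G (u i) = 1"
      by simp
    then have "subst ?F (w i) * subst ?F (subst ?G (u i)) = 1"
      by (simp only: subst_hom.hom_one flip: subst_hom.hom_mult)
    \<comment> \<open>The composition in the other order, \<open>G \<circ> F = id\<close>, enters
      here: it replaces each \<open>x_j\<close> in \<open>u i\<close> by itself.\<close>
    moreover have "subst ?F (subst ?G (u i)) = u i"
      unfolding subst_subst by (rule subst_eq_self[OF ring(2)]) (use i GF in auto)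
    ultimately show ?thesis
      unfolding Units_mpol_ring_iff by (intro conjI bexI[OF _ F_ring[OF ring(4)]] ring(2)) simp
  qed
qed

section \<open>The group of units of \<open>MT n\<close>\<close>

theorem theorem3p13:
  fixes n :: nat
  assumes "n > 1"
  shows "Units (MT n :: (nat \<Rightarrow> 'a::comm_ring_1 mpol) monoid) =
    {elem_product n f u | f u.
       R_automorphism (f 1) \<and>
       (\<forall>i\<in>{2..n}. f i \<in> carrier (mpol_ring (i - 1)) \<and> u i \<in> Units (mpol_ring (i - 1)))}"
    (is "_ = ?E")
proof (intro equalityI subsetI)
  fix F :: "nat \<Rightarrow> 'a mpol" assume "F \<in> Units (MT n)"
  then obtain G where F: "F \<in> carrier (MT n)" and G: "G \<in> carrier (MT n)"
    and inv: "tuple_comp n G F = tuple_id n" "tuple_comp n F G = tuple_id n"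
    by (auto simp: Units_def)
  obtain f u where F_eq: "F = triangular n f u" and f: "f 1 \<in> carrier (mpol_ring 1)"
    "\<And>i. i \<in> {2..n} \<Longrightarrow> f i \<in> carrier (mpol_ring (i - 1)) \<and> u i \<in> carrier (mpol_ring (i - 1))"
    using F unfolding carrier_MT permutation_polynomial_def unit_valued_def by blast
  obtain g w where G_eq: "G = triangular n g w" and g: "g 1 \<in> carrier (mpol_ring 1)"
    "\<And>i. i \<in> {2..n} \<Longrightarrow> g i \<in> carrier (mpol_ring (i - 1)) \<and> w i \<in> carrier (mpol_ring (i - 1))"
    using G unfolding carrier_MT permutation_polynomial_def unit_valued_def by blast
  have n: "n \<ge> 1" using assms by simp
  have "R_automorphism (f 1)" "\<And>i. i \<in> {2..n} \<Longrightarrow> u i \<in> Units (mpol_ring (i - 1))"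
    using triangular_invertible_components[OF f g inv[unfolded F_eq G_eq] n] by blast+
  moreover have "F = elem_product n f u"
    using elem_product_eq_triangular[OF n f] F_eq by simp
  ultimately show "F \<in> ?E"
    using f(2) by blast
next
  fix F assume "F \<in> ?E"
  then obtain f u where F: "F = elem_product n f u" and f1: "R_automorphism (f 1)"
    and f: "\<And>i. i \<in> {2..n} \<Longrightarrow> f i \<in> carrier (mpol_ring (i - 1))"
    and u: "\<And>i. i \<in> {2..n} \<Longrightarrow> u i \<in> Units (mpol_ring (i - 1))"
    by blast
  have n: "n \<ge> 1" using assms by simp
  have u_ring: "u i \<in> carrier (mpol_ring (i - 1))" and u_val: "unit_valued (i - 1) (u i)"
    if "i \<in> {2..n}" for i
    using u[OF that] unit_valued_if_unit by (auto simp: Units_mpol_ring_iff)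
  have "F = triangular n f u"
    unfolding F using n f u_ring f1 by (intro elem_product_eq_triangular) (auto simp: R_automorphism_iff)
  \<comment> \<open>Automorphisms of \<open>R[x_1]\<close> permute \<open>R\<close>, and units are
    unit-valued, so the tuple lies in the monoid before its inverse is considered.\<close>
  moreover have "triangular n f u \<in> carrier (MT n)"
    unfolding carrier_MT using R_automorphism_permutation_polynomial[OF f1] f u_val by blast
  ultimately show "F \<in> Units (MT n)"
    using triangular_inverse_exists[OF f1 f u n] by (auto simp: Units_def)
qed

end
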